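(* Let $(\Omega,\Sigma,P_{\mathbb{D}})$ be a $\mathbb{D}$-probabilistic space, let $X_{\mathbb{D}}$ and $Y_{\mathbb{D}}$ be $\mathbb{D}$-random variables on it which are integrable, and let $\alpha,\beta\in\mathbb{D}$ be hyperbolic numbers. Then $\alpha X_{\mathbb{D}}+\beta Y_{\mathbb{D}}$ is integrable and $$\int_{\Omega}(\alpha X_{\mathbb{D}}+\beta Y_{\mathbb{D}})\,dP_{\mathbb{D}}=\alpha\int_{\Omega}X_{\mathbb{D}}\,dP_{\mathbb{D}}+\beta\int_{\Omega}Y_{\mathbb{D}}\,dP_{\mathbb{D}} .$$
   Context: The hyperbolic numbers are the commutative ring $\mathbb{D}=\{a+bk \mid a,b\in\mathbb{R},\ k^2=1,\ k\notin\mathbb{R}\}$. Put $e=\frac{1+k}{2}$, $e^{\dagger}=\frac{1-k}{2}$ (so $e^2=e$, $(e^\dagger)^2=e^\dagger$, $ee^\dagger=0$, $e+e^\dagger=1$); every $z=a+bk$ is uniquely $z=v_1e+v_2e^{\dagger}$ with $v_1=a+b$, $v_2=a-b\in\mathbb{R}$, and all algebraic operations are componentwise in $(v_1,v_2)$. Let $\mathbb{D}^+=\{v_1e+v_2e^\dagger \mid v_1,v_2\ge 0\}$ and write $z_1\preceq z_2$ if $z_2-z_1\in\mathbb{D}^+$. The topology on $\mathbb{D}$ is the usual topology of $\mathbb{R}^2$ in the coordinates $(v_1,v_2)$. A $\mathbb{D}$-probabilistic space $(\Omega,\Sigma,P_{\mathbb{D}})$ is a measurable space $(\Omega,\Sigma)$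 with a function $P_{\mathbb{D}}\colon\Sigma\to\mathbb{D}$ such that $P_{\mathbb{D}}(A)\succeq 0$ for all $A\in\Sigma$, $P_{\mathbb{D}}(\Omega)\in\{1,e,e^\dagger\}$, and $P_{\mathbb{D}}$ is countably additive on pairwise disjoint sequences in $\Sigma$. Write $P_{\mathbb{D}}=P_1e+P_2e^\dagger$; $P_1,P_2$ are ordinary real measures on $\Sigma$ (each a probability measure or zero). A $\mathbb{D}$-random variable is a function $X_{\mathbb{D}}\colon\Omega\to\mathbb{D}$ with $X_{\mathbb{D}}^{-1}(U)\in\Sigma$ for every open $U\subset\mathbb{D}$; equivalently $X_{\mathbb{D}}=eX_1+e^\dagger X_2$ with $X_1,X_2$ real measurable functions. It is integrable if $X_1$ is Lebesgue integrable with respect to $P_1$ and $X_2$ with respect to $P_2$, and then $\int_\Omega X_{\mathbb{D}}\,dP_{\mathbb{D}}=e\int_\Omega X_1\,dP_1+e^\dagger\int_\Omega X_2\,dP_2$. *)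

theory Defs
  imports "HOL-Analysis.Analysis"
begin

section \<open>Hyperbolic numbers\<close>

text \<open>\<open>Hyp a b\<close> stands for \<open>a + b k\<close>, where \<open>k * k = 1\<close>.\<close>

datatype hyperbolic = Hyp (real_part: real) (k_part: real)

instantiation hyperbolic :: comm_ring_1
begin

definition "0 = Hyp 0 0"

definition "1 = Hyp 1 0"

definition "z + w = Hyp (real_part z + real_part w) (k_part z + k_part w)"

definition "- z = Hyp (- real_part z) (- k_part z)"

definition "z - w = Hyp (real_part z - real_part w) (k_part z - k_part w)"

definition "z * w = Hyp (real_part z * real_part w + k_part z * k_part w)
                        (real_part z * k_part w + k_part z * real_part w)"

instance
  by standard
    (simp_all add: zero_hyperbolic_def one_hyperbolic_def plus_hyperbolic_def
      uminus_hyperbolic_def minus_hyperbolic_def times_hyperbolic_def algebra_simps)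

end

instantiation hyperbolic :: real_algebra_1
begin

definition "r *\<^sub>R z = Hyp (r * real_part z) (r * k_part z)"

instance
  by standard
    (simp_all add: scaleR_hyperbolic_def plus_hyperbolic_def times_hyperbolic_def algebra_simps)

end

lemmas hyperbolic_ops =
  zero_hyperbolic_def one_hyperbolic_def plus_hyperbolic_def uminus_hyperbolic_def
  minus_hyperbolic_def times_hyperbolic_def scaleR_hyperbolic_def

definition hyp_k :: hyperbolic where
  "hyp_k = Hyp 0 1"

definition hyp_e :: hyperbolic where
  "hyp_e = (1 / 2) *\<^sub>R (1 + hyp_k)"

definition hyp_ed :: hyperbolic where
  "hyp_ed = (1 / 2) *\<^sub>R (1 - hyp_k)"

lemmas hyp_e_defs = hyp_k_def hyp_e_def hyp_ed_def

lemma hyp_k_square: "hyp_k * hyp_k = 1"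
  by (simp add: hyp_e_defs hyperbolic_ops)

lemma Hyp_eq: "Hyp a b = of_real a + of_real b * hyp_k"
  by (simp add: hyp_e_defs hyperbolic_ops of_real_def)

lemma hyp_e_idem:
  "hyp_e * hyp_e = hyp_e" "hyp_ed * hyp_ed = hyp_ed"
  "hyp_e * hyp_ed = 0" "hyp_ed * hyp_e = 0" "hyp_e + hyp_ed = 1"
  by (simp_all add: hyp_e_defs hyperbolic_ops)

text \<open>The coordinates \<open>v\<^sub>1\<close>, \<open>v\<^sub>2\<close> of \<open>z = v\<^sub>1 e + v\<^sub>2 e\<^sup>\<dagger>\<close>.\<close>

definition idem1 :: "hyperbolic \<Rightarrow> real" where
  "idem1 z = real_part z + k_part z"

definition idem2 :: "hyperbolic \<Rightarrow> real" where
  "idem2 z = real_part z - k_part z"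

definition of_idem :: "real \<times> real \<Rightarrow> hyperbolic" where
  "of_idem = (\<lambda>(v1, v2). v1 *\<^sub>R hyp_e + v2 *\<^sub>R hyp_ed)"

lemma idem_of_idem [simp]: "idem1 (of_idem v) = fst v" "idem2 (of_idem v) = snd v"
  by (cases v; simp add: of_idem_def idem1_def idem2_def hyp_e_defs hyperbolic_ops field_simps)+

lemma of_idem_idem [simp]: "of_idem (idem1 z, idem2 z) = z"
  by (cases z) (simp add: of_idem_def idem1_def idem2_def hyp_e_defs hyperbolic_ops field_simps)

lemma hyperbolic_eq_iff: "z = w \<longleftrightarrow> idem1 z = idem1 w \<and> idem2 z = idem2 w"
  by (metis of_idem_idem)

definition hyp_nonneg :: "hyperbolic set" where
  "hyp_nonneg = {v1 *\<^sub>R hyp_e + v2 *\<^sub>R hyp_ed | v1 v2. v1 \<ge> 0 \<and> v2 \<ge> 0}"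

lemma hyp_nonneg_iff: "z \<in> hyp_nonneg \<longleftrightarrow> idem1 z \<ge> 0 \<and> idem2 z \<ge> 0"
proof
  assume "z \<in> hyp_nonneg"
  then obtain v1 v2 where "z = of_idem (v1, v2)" "v1 \<ge> 0" "v2 \<ge> 0"
    by (auto simp: hyp_nonneg_def of_idem_def)
  then show "idem1 z \<ge> 0 \<and> idem2 z \<ge> 0" by simp
next
  assume *: "idem1 z \<ge> 0 \<and> idem2 z \<ge> 0"
  have "z = idem1 z *\<^sub>R hyp_e + idem2 z *\<^sub>R hyp_ed"
    using of_idem_idem [of z] by (simp add: of_idem_def)
  with * show "z \<in> hyp_nonneg" unfolding hyp_nonneg_def by blast
qed

lemma idem_ops [simp]:
  "idem1 0 = 0" "idem2 0 = 0" "idem1 1 = 1" "idem2 1 = 1"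
  "idem1 hyp_e = 1" "idem2 hyp_e = 0" "idem1 hyp_ed = 0" "idem2 hyp_ed = 1"
  "idem1 (z + w) = idem1 z + idem1 w" "idem2 (z + w) = idem2 z + idem2 w"
  "idem1 (z - w) = idem1 z - idem1 w" "idem2 (z - w) = idem2 z - idem2 w"
  "idem1 (z * w) = idem1 z * idem1 w" "idem2 (z * w) = idem2 z * idem2 w"
  "idem1 (r *\<^sub>R z) = r * idem1 z" "idem2 (r *\<^sub>R z) = r * idem2 z"
  by (simp_all add: idem1_def idem2_def hyp_e_defs hyperbolic_ops algebra_simps)

text \<open>The partial order: \<open>z \<le> w\<close> iff \<open>w - z \<in> \<DD>\<^sup>+\<close>.\<close>

instantiation hyperbolic :: order
begin

definition "z \<le> w \<longleftrightarrow> w - z \<in> hyp_nonneg"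

definition "z < w \<longleftrightarrow> z \<le> w \<and> \<not> w \<le> (z :: hyperbolic)"

instance
  by standard
    (auto simp: less_eq_hyperbolic_def less_hyperbolic_def hyp_nonneg_iff hyperbolic_eq_iff)

end

text \<open>The topology of \<open>\<real>\<^sup>2\<close> in the coordinates \<open>(v\<^sub>1, v\<^sub>2)\<close>.\<close>

instantiation hyperbolic :: topological_space
begin

definition "open U \<longleftrightarrow> open (of_idem -` U)"

instance
  by standard (auto simp: open_hyperbolic_def vimage_Union)

end

lemma open_vimage_idem:
  assumes "open U"
  shows "open (idem1 -` U)" "open (idem2 -` U)"
proof -
  have "of_idem -` (idem1 -` U) = U \<times> UNIV" "of_idem -` (idem2 -` U) = UNIV \<times> U"
    by auto
  then show "open (idem1 -` U)" "open (idem2 -` U)"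
    using assms by (simp_all add: open_hyperbolic_def open_Times)
qed

lemma tendsto_idem:
  assumes "(f \<longlongrightarrow> l) F"
  shows "((\<lambda>x. idem1 (f x)) \<longlongrightarrow> idem1 l) F" "((\<lambda>x. idem2 (f x)) \<longlongrightarrow> idem2 l) F"
  using topological_tendstoD [OF assms open_vimage_idem(1)]
    topological_tendstoD [OF assms open_vimage_idem(2)]
  by (auto intro!: topological_tendstoI)

lemma sums_idem:
  assumes "f sums l"
  shows "(\<lambda>n. idem1 (f n)) sums idem1 l" "(\<lambda>n. idem2 (f n)) sums idem2 l"
proof -
  have "idem1 (sum f A) = (\<Sum>n\<in>A. idem1 (f n))" "idem2 (sum f A) = (\<Sum>n\<in>A. idem2 (f n))"
    for A :: "nat set"
    by (induction A rule: infinite_finite_induct) auto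
  with tendsto_idem [OF assms [unfolded sums_def]]
  show "(\<lambda>n. idem1 (f n)) sums idem1 l" "(\<lambda>n. idem2 (f n)) sums idem2 l"
    by (simp_all add: sums_def)
qed


section \<open>Probabilistic spaces with hyperbolic values\<close>

locale hyp_prob_space = sigma_algebra \<Omega> \<Sigma>
  for \<Omega> :: "'a set" and \<Sigma> :: "'a set set" +
  fixes P :: "'a set \<Rightarrow> hyperbolic"
  assumes nonneg: "A \<in> \<Sigma> \<Longrightarrow> 0 \<le> P A"
    and total: "P \<Omega> \<in> {1, hyp_e, hyp_ed}"
    and sums_disjoint:
      "range B \<subseteq> \<Sigma> \<Longrightarrow> disjoint_family B \<Longrightarrow> (\<lambda>n. P (B n)) sums P (\<Union>n :: nat. B n)"

definition comp_measure1 :: "'a set \<Rightarrow> 'a set set \<Rightarrow> ('a set \<Rightarrow> hyperbolic) \<Rightarrow> 'a measure" where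
  "comp_measure1 \<Omega> \<Sigma> P = measure_of \<Omega> \<Sigma> (\<lambda>A. ennreal (idem1 (P A)))"

definition comp_measure2 :: "'a set \<Rightarrow> 'a set set \<Rightarrow> ('a set \<Rightarrow> hyperbolic) \<Rightarrow> 'a measure" where
  "comp_measure2 \<Omega> \<Sigma> P = measure_of \<Omega> \<Sigma> (\<lambda>A. ennreal (idem2 (P A)))"

text \<open>
  \<^const>\<open>measure_of\<close> silently returns the zero measure when its argument is not a measure;
  the following shows that this does not happen here.
\<close>

lemma (in hyp_prob_space) emeasure_comp_measure:
  assumes "A \<in> \<Sigma>"
  shows "emeasure (comp_measure1 \<Omega> \<Sigma> P) A = ennreal (idem1 (P A))"
    and "emeasure (comp_measure2 \<Omega> \<Sigma> P) A = ennreal (idem2 (P A))"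
proof -
  have nn: "0 \<le> idem1 (P B)" "0 \<le> idem2 (P B)" if "B \<in> \<Sigma>" for B
    using nonneg [OF that] by (auto simp: less_eq_hyperbolic_def hyp_nonneg_iff)
  have "(\<lambda>n :: nat. P {}) sums P {}"
    using sums_disjoint [of "\<lambda>_. {}"] by (simp add: disjoint_family_on_def)
  then have "summable (\<lambda>n :: nat. idem1 (P {}))" "summable (\<lambda>n :: nat. idem2 (P {}))"
    by (blast dest: sums_idem sums_summable)+
  then have empty: "idem1 (P {}) = 0" "idem2 (P {}) = 0"
    by (simp_all add: summable_const_iff)
  have add1: "countably_additive \<Sigma> (\<lambda>A. ennreal (idem1 (P A)))"
    and add2: "countably_additive \<Sigma> (\<lambda>A. ennreal (idem2 (P A)))"
    unfolding countably_additive_def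
    using sums_disjoint
    by (auto intro!: sums_unique [symmetric] sums_ennreal [THEN iffD2] sums_idem nn
        dest: range_subsetD)
  show "emeasure (comp_measure1 \<Omega> \<Sigma> P) A = ennreal (idem1 (P A))"
    unfolding comp_measure1_def
    by (rule emeasure_measure_of_sigma)
      (use assms empty add1 sigma_algebra_axioms in \<open>auto simp: positive_def\<close>)
  show "emeasure (comp_measure2 \<Omega> \<Sigma> P) A = ennreal (idem2 (P A))"
    unfolding comp_measure2_def
    by (rule emeasure_measure_of_sigma)
      (use assms empty add2 sigma_algebra_axioms in \<open>auto simp: positive_def\<close>)
qed

definition hyp_random_variable :: "'a set \<Rightarrow> 'a set set \<Rightarrow> ('a \<Rightarrow> hyperbolic) \<Rightarrow> bool" where
  "hyp_random_variable \<Omega> \<Sigma> X \<longleftrightarrow> (\<forall>U. open U \<longrightarrow> X -` U \<inter> \<Omega> \<in> \<Sigma>)"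

definition hyp_integrable ::
  "'a set \<Rightarrow> 'a set set \<Rightarrow> ('a set \<Rightarrow> hyperbolic) \<Rightarrow> ('a \<Rightarrow> hyperbolic) \<Rightarrow> bool" where
  "hyp_integrable \<Omega> \<Sigma> P X \<longleftrightarrow>
     hyp_random_variable \<Omega> \<Sigma> X \<and>
     integrable (comp_measure1 \<Omega> \<Sigma> P) (\<lambda>\<omega>. idem1 (X \<omega>)) \<and>
     integrable (comp_measure2 \<Omega> \<Sigma> P) (\<lambda>\<omega>. idem2 (X \<omega>))"

definition hyp_integral ::
  "'a set \<Rightarrow> 'a set set \<Rightarrow> ('a set \<Rightarrow> hyperbolic) \<Rightarrow> ('a \<Rightarrow> hyperbolic) \<Rightarrow> hyperbolic" where
  "hyp_integral \<Omega> \<Sigma> P X =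
     (LINT \<omega>|comp_measure1 \<Omega> \<Sigma> P. idem1 (X \<omega>)) *\<^sub>R hyp_e +
     (LINT \<omega>|comp_measure2 \<Omega> \<Sigma> P. idem2 (X \<omega>)) *\<^sub>R hyp_ed"

end

theory Submission imports Defs begin

text \<open>In the coordinates \<open>idem1\<close>, \<open>idem2\<close> both ring operations act
  componentwise, so each coordinate of \<alpha> X + \<beta> Y is a real linear combination of the
  same coordinate of X and of Y. Integrability and the integral are also defined coordinate by
  coordinate, so the claim splits into linearity of two real Lebesgue integrals, one for each
  component measure. Measurability is defined by open sets of hyperbolic numbers instead;
  \<open>hyp_random_variable_iff\<close> transfers it to the coordinates.\<close>

lemma idem_hyp_integral [simp]:
  "idem1 (hyp_integral \<Omega> \<Sigma> P X) = (LINT \<omega>|comp_measure1 \<Omega> \<Sigma> P. idem1 (X \<omega>))"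
  "idem2 (hyp_integral \<Omega> \<Sigma> P X) = (LINT \<omega>|comp_measure2 \<Omega> \<Sigma> P. idem2 (X \<omega>))"
  by (simp_all add: hyp_integral_def)

text \<open>The coordinate map is a homeomorphism onto the real plane, whose Borel maps are exactly
  the pairs of Borel functions. Measurability depends only on the sets, so
  \<open>sigma \<Omega> M\<close> serves for both component measures.\<close>

lemma (in sigma_algebra) hyp_random_variable_iff:
  "hyp_random_variable \<Omega> M X \<longleftrightarrow>
     (\<lambda>\<omega>. idem1 (X \<omega>)) \<in> borel_measurable (sigma \<Omega> M) \<and>
     (\<lambda>\<omega>. idem2 (X \<omega>)) \<in> borel_measurable (sigma \<Omega> M)"
proof
  assume X: "hyp_random_variable \<Omega> M X"
  \<comment> \<open>Continuity is all that is used of a coordinate, so one argument covers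
    both.\<close>
  have "(\<lambda>\<omega>. f (X \<omega>)) \<in> borel_measurable (sigma \<Omega> M)"
    if f: "\<And>U. open U \<Longrightarrow> open (f -` U)" for f :: "hyperbolic \<Rightarrow> real"
  proof (rule borel_measurableI)
    fix U :: "real set" assume "open U"
    then have "X -` (f -` U) \<inter> \<Omega> \<in> M"
      using X f by (simp add: hyp_random_variable_def)
    then show "(\<lambda>\<omega>. f (X \<omega>)) -` U \<inter> space (sigma \<Omega> M) \<in> sets (sigma \<Omega> M)"
      by (simp add: vimage_def space_measure_of_conv)
  qed
  then show "(\<lambda>\<omega>. idem1 (X \<omega>)) \<in> borel_measurable (sigma \<Omega> M) \<and>
    (\<lambda>\<omega>. idem2 (X \<omega>)) \<in> borel_measurable (sigma \<Omega> M)"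
    using open_vimage_idem by blast
next
  assume "(\<lambda>\<omega>. idem1 (X \<omega>)) \<in> borel_measurable (sigma \<Omega> M) \<and>
    (\<lambda>\<omega>. idem2 (X \<omega>)) \<in> borel_measurable (sigma \<Omega> M)"
  then have meas: "(\<lambda>\<omega>. (idem1 (X \<omega>), idem2 (X \<omega>))) \<in> borel_measurable (sigma \<Omega> M)"
    by (intro borel_measurable_Pair) auto
  show "hyp_random_variable \<Omega> M X"
    unfolding hyp_random_variable_def
  proof (intro allI impI)
    fix U :: "hyperbolic set" assume "open U"
    then have "of_idem -` U \<in> sets borel"
      by (simp add: open_hyperbolic_def)
    from measurable_sets [OF meas this] show "X -` U \<inter> \<Omega> \<in> M"
      by (simp add: vimage_def space_measure_of_conv)
  qed
qed

theorem theorem3p7: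
  fixes \<Omega> :: "'a set" and \<Sigma> :: "'a set set" and P :: "'a set \<Rightarrow> hyperbolic"
    and X Y :: "'a \<Rightarrow> hyperbolic" and \<alpha> \<beta> :: hyperbolic
  assumes "hyp_prob_space \<Omega> \<Sigma> P"
    and "hyp_random_variable \<Omega> \<Sigma> X" and "hyp_random_variable \<Omega> \<Sigma> Y"
    and "hyp_integrable \<Omega> \<Sigma> P X" and "hyp_integrable \<Omega> \<Sigma> P Y"
  shows "hyp_integrable \<Omega> \<Sigma> P (\<lambda>\<omega>. \<alpha> * X \<omega> + \<beta> * Y \<omega>) \<and>
    hyp_integral \<Omega> \<Sigma> P (\<lambda>\<omega>. \<alpha> * X \<omega> + \<beta> * Y \<omega>) =
      \<alpha> * hyp_integral \<Omega> \<Sigma> P X + \<beta> * hyp_integral \<Omega> \<Sigma> P Y"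
proof -
  interpret hyp_prob_space \<Omega> \<Sigma> P by fact
  \<comment> \<open>The coordinates of \<alpha> and \<beta> are real constants, so closure of real
    Borel functions under sums and products suffices.\<close>
  have "hyp_random_variable \<Omega> \<Sigma> (\<lambda>\<omega>. \<alpha> * X \<omega> + \<beta> * Y \<omega>)"
    using assms(2,3) unfolding hyp_random_variable_iff by (auto intro!: borel_measurable_add borel_measurable_times)
  then show ?thesis
    \<comment> \<open>\<open>hyperbolic_eq_iff\<close> turns the hyperbolic equation into two real
      ones, and \<open>idem_hyp_integral\<close> makes each an instance of linearity of the Lebesgue
      integral.\<close>
    using assms(4,5) by (simp add: hyp_integrable_def hyperbolic_eq_iff)
qed

end
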